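(* Let $\mathbf r(s)=(x(s),y(s),z(s))$ be a smooth horizontally regular curve in $\mathbb H_1$ parametrized by horizontal arc length $s$, with $p$-curvature $\kappa$. Under the standard coordinate identification $\mathbb H_1\simeq\mathbb R^3$, a distinct smooth horizontally regular curve $\bar{\mathbf r}(\bar s)=(\bar x(\bar s),\bar y(\bar s),\bar z(\bar s))$, parametrized by horizontal arc length $\bar s$, is an adapted Bertrand mate of $\mathbf r$ if and only if there exist a constant $a\in\mathbb R\setminus\{0\}$ such that $1-a\kappa(s)>0$ for all $s$, and a correspondence $\bar s=\bar s(s)$ with $$\frac{d\bar s}{ds}=1-a\kappa(s),$$ such that for all $s$ $$\bar x(\bar s(s))=x(s)-a\,y'(s),\qquad \bar y(\bar s(s))=y(s)+a\,x'(s).$$ Moreover, in this case the $p$-curvature $\bar\kappa$ of the adapted Bertrand mate $\bar{\mathbf r}$ is given by $$\bar\kappa(\bar s(s))=\frac{\kappa(s)}{1-a\kappa(s)} .$$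
   Context: The Heisenberg group $\mathbb H_1$ is identified with $\mathbb R^3$ through its standard coordinates $(x,y,z)$; left translation by $(x,y,z)$ is $(a,b,c)\mapsto(a+x,b+y,c+z+ya-xb)$. The standard left-invariant horizontal frame at $(x,y,z)$ is $\mathring{\mathbf e}_1=(1,0,y)$, $\mathring{\mathbf e}_2=(0,1,-x)$. A smooth curve $\mathbf r=(x,y,z)$ defined on an interval is horizontally regular if $(x')^2+(y')^2\neq0$ everywhere; it is parametrized by horizontal arc length if $(x')^2+(y')^2\equiv1$. All curves are smooth and parametrized by horizontal arc length. The adapted normal field, in the coordinates of $\mathbb R^3$, is $\mathbf n=-y'\mathring{\mathbf e}_1+x'\mathring{\mathbf e}_2=(-y',x',-yy'-xx')$, and the $p$-curvature is $\kappa=x'y''-x''y'$. For $\bar{\mathbf r}$ the corresponding objects $\bar{\mathbf n},\bar\kappa$ are formed with derivatives with respect to its horizontal arc length $\bar s$. Definition. A horizontally regular curve $\bar{\mathbf r}$, distinct from $\mathbf r$, is an adapted Bertrand mate of $\mathbf r$ if there is an orientation-preserving correspondence $\bar s=\bar s(s)$ (a smooth reparametrization from the parameter interval of $\mathbf r$ onto that of $\bar{\mathbf r}$ with $d\bar s/ds>0$) such that, as vectors and points of $\mathbb R^3$, $$\bar{\mathbf n}(\bar s(s))=\mathbf n(s)\quad\text{and}\quad \pi_{xy}(\bar{\mathbf r}(\bar s(s)))\neq\pi_{xy}(\mathbf r(s))\quad\text{for all }s,$$ where $\pi_{xy}(x,y,z)=(x,y)$. In the theorem, "correspondence" also means a smooth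 map from the parameter interval of $\mathbf r$ onto that of $\bar{\mathbf r}$. *)

theory Defs
  imports "HOL-Analysis.Analysis"
begin

text \<open>The Heisenberg group is identified with \<^typ>\<open>real^3\<close>. A curve is a function
  \<^term>\<open>r :: real \<Rightarrow> real^3\<close> together with a parameter interval \<^term>\<open>I\<close>; only the values of
  \<^term>\<open>r\<close> on \<^term>\<open>I\<close> matter. The interval may be open, closed, half-open or unbounded, so all
  derivatives are taken within \<^term>\<open>I\<close> (one-sided at endpoints belonging to \<^term>\<open>I\<close>).\<close>

definition param_interval :: "real set \<Rightarrow> bool" where
  "param_interval I \<longleftrightarrow> is_interval I \<and> interior I \<noteq> {}"

definition deriv_on :: "real set \<Rightarrow> (real \<Rightarrow> 'a::real_normed_vector) \<Rightarrow> real \<Rightarrow> 'a" where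
  "deriv_on I f s = vector_derivative f (at s within I)"

definition smooth_on :: "real set \<Rightarrow> (real \<Rightarrow> 'a::real_normed_vector) \<Rightarrow> bool" where
  "smooth_on I f \<longleftrightarrow> (\<forall>n. \<forall>s\<in>I. (deriv_on I ^^ n) f differentiable (at s within I))"

definition e1 :: "real^3 \<Rightarrow> real^3" where
  "e1 p = vector [1, 0, p$2]"

definition e2 :: "real^3 \<Rightarrow> real^3" where
  "e2 p = vector [0, 1, - (p$1)]"

definition pi_xy :: "real^3 \<Rightarrow> real \<times> real" where
  "pi_xy p = (p$1, p$2)"

definition horizontally_regular :: "real set \<Rightarrow> (real \<Rightarrow> real^3) \<Rightarrow> bool" where
  "horizontally_regular I r \<longleftrightarrow> param_interval I \<and> smooth_on I r \<and>
     (\<forall>s\<in>I. (deriv_on I r s $ 1)\<^sup>2 + (deriv_on I r s $ 2)\<^sup>2 \<noteq> 0)"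

definition horizontal_arc_length_param :: "real set \<Rightarrow> (real \<Rightarrow> real^3) \<Rightarrow> bool" where
  "horizontal_arc_length_param I r \<longleftrightarrow>
     (\<forall>s\<in>I. (deriv_on I r s $ 1)\<^sup>2 + (deriv_on I r s $ 2)\<^sup>2 = 1)"

text \<open>The adapted normal and the p-curvature below are meant for curves parametrized by
  horizontal arc length.\<close>

definition adapted_normal :: "real set \<Rightarrow> (real \<Rightarrow> real^3) \<Rightarrow> real \<Rightarrow> real^3" where
  "adapted_normal I r s =
     - (deriv_on I r s $ 2) *\<^sub>R e1 (r s) + (deriv_on I r s $ 1) *\<^sub>R e2 (r s)"

lemma adapted_normal_coordinates:
  "adapted_normal I r s = vector [- (deriv_on I r s $ 2), deriv_on I r s $ 1,
     - (r s $ 2) * (deriv_on I r s $ 2) - (r s $ 1) * (deriv_on I r s $ 1)]"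
  by (simp add: adapted_normal_def e1_def e2_def vec_eq_iff forall_3)

definition p_curvature :: "real set \<Rightarrow> (real \<Rightarrow> real^3) \<Rightarrow> real \<Rightarrow> real" where
  "p_curvature I r s =
     (deriv_on I r s $ 1) * ((deriv_on I ^^ 2) r s $ 2) -
     ((deriv_on I ^^ 2) r s $ 1) * (deriv_on I r s $ 2)"

definition correspondence :: "real set \<Rightarrow> real set \<Rightarrow> (real \<Rightarrow> real) \<Rightarrow> bool" where
  "correspondence I J \<sigma> \<longleftrightarrow> smooth_on I \<sigma> \<and> \<sigma> ` I = J"

definition orientation_preserving :: "real set \<Rightarrow> (real \<Rightarrow> real) \<Rightarrow> bool" where
  "orientation_preserving I \<sigma> \<longleftrightarrow> (\<forall>s\<in>I. 0 < deriv_on I \<sigma> s)"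

text \<open>Distinctness is that of parametrized curves, i.e. of functions on their parameter intervals;
  curves with different traces are in particular distinct in this sense.\<close>

definition distinct_curves ::
    "real set \<Rightarrow> (real \<Rightarrow> real^3) \<Rightarrow> real set \<Rightarrow> (real \<Rightarrow> real^3) \<Rightarrow> bool" where
  "distinct_curves I r J rb \<longleftrightarrow> \<not> (I = J \<and> (\<forall>s\<in>I. rb s = r s))"

definition adapted_Bertrand_mate ::
    "real set \<Rightarrow> (real \<Rightarrow> real^3) \<Rightarrow> real set \<Rightarrow> (real \<Rightarrow> real^3) \<Rightarrow> bool" where
  "adapted_Bertrand_mate I r J rb \<longleftrightarrow>
     horizontally_regular I r \<and> horizontal_arc_length_param I r \<and>
     horizontally_regular J rb \<and> horizontal_arc_length_param J rb \<and>
     distinct_curves I r J rb \<and>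
     (\<exists>\<sigma>. correspondence I J \<sigma> \<and> orientation_preserving I \<sigma> \<and>
        (\<forall>s\<in>I. adapted_normal J rb (\<sigma> s) = adapted_normal I r s \<and>
               pi_xy (rb (\<sigma> s)) \<noteq> pi_xy (r s)))"

end

theory Submission
  imports Defs
begin

text \<open>Put \<open>(X, Y) = \<pi>\<^sub>x\<^sub>y(rb \<circ> \<sigma>) - \<pi>\<^sub>x\<^sub>y(r)\<close>. The first two coordinates of
  the adapted normals agree iff the horizontal tangents do, and then the third coordinates agree
  iff \<open>X x' + Y y' = 0\<close>, that is, \<open>(X, Y) = a (- y', x')\<close>. Differentiating, the equality of
  tangents and the Frenet equations \<open>x'' = - \<kappa> y'\<close>, \<open>y'' = \<kappa> x'\<close> give \<open>a' = 0\<close> and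
  \<open>\<sigma>' = 1 - a \<kappa>\<close>. Conversely the offset curve \<open>(x - a y', y + a x')\<close> has velocity
  \<open>(1 - a \<kappa>) (x', y')\<close>, so that \<open>\<sigma>' = 1 - a \<kappa>\<close> makes the tangents agree.
  Differentiating the equality of tangents once more gives the curvature.\<close>

section \<open>Differentiation within a parameter interval\<close>

text \<open>A connected set with more than one point has no isolated points. This makes derivatives
  within \<open>I\<close> unique, also at endpoints.\<close>

lemma param_interval_islimpt:
  assumes "param_interval I" "s \<in> I"
  shows "s islimpt I"
proof -
  have "connected I" "interior I \<noteq> {}"
    using assms by (auto simp: param_interval_def is_interval_connected)
  moreover have "I \<noteq> {s}"
    using \<open>interior I \<noteq> {}\<close> by auto
  ultimately show ?thesis
    using assms(2) connected_imp_perfect by blast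
qed

lemma has_vector_derivative_deriv_on_funpow:
  assumes "smooth_on I f" "s \<in> I"
  shows "((deriv_on I ^^ n) f has_vector_derivative (deriv_on I ^^ Suc n) f s) (at s within I)"
  using assms by (simp add: smooth_on_def deriv_on_def vector_derivative_works)

text \<open>Allows an identity valid on all of \<open>I\<close> to be differentiated on both sides.
  The unit-speed condition, the offset equations and the equality of tangents are all used through
  it.\<close>

lemma param_interval_has_real_derivative_unique:
  assumes "param_interval I" "s \<in> I" "\<And>t. t \<in> I \<Longrightarrow> f t = g t"
    and "(f has_real_derivative D) (at s within I)" "(g has_real_derivative E) (at s within I)"
  shows "D = E"
proof -
  have "(f has_real_derivative E) (at s within I)"
    using has_vector_derivative_transform[OF assms(2,3)] assms(5)
    by (simp add: has_real_derivative_iff_has_vector_derivative)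
  moreover have "at s within I \<noteq> bot"
    using param_interval_islimpt[OF assms(1,2)] by (simp add: trivial_limit_within)
  ultimately show ?thesis
    using assms(4) vector_derivative_unique_within has_real_derivative_iff_has_vector_derivative
    by metis
qed

lemma has_real_derivative_nth:
  assumes "(f has_vector_derivative D) (at s within I)"
  shows "((\<lambda>t. f t $ i) has_real_derivative D $ i) (at s within I)"
  using bounded_linear.has_vector_derivative[OF bounded_linear_vec_nth assms]
  by (simp add: has_real_derivative_iff_has_vector_derivative)

lemma has_real_derivative_curve:
  assumes "horizontally_regular I r" "s \<in> I"
  shows "((\<lambda>t. r t $ i) has_real_derivative deriv_on I r s $ i) (at s within I)"
    and "((\<lambda>t. deriv_on I r t $ i) has_real_derivative (deriv_on I ^^ 2) r s $ i) (at s within I)"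
proof -
  have "smooth_on I r"
    using assms by (simp add: horizontally_regular_def)
  note d = has_vector_derivative_deriv_on_funpow[OF this assms(2), THEN has_real_derivative_nth]
  show "((\<lambda>t. r t $ i) has_real_derivative deriv_on I r s $ i) (at s within I)"
    using d[of 0] by simp
  show "((\<lambda>t. deriv_on I r t $ i) has_real_derivative (deriv_on I ^^ 2) r s $ i) (at s within I)"
    using d[of 1] by (simp add: numeral_2_eq_2)
qed

text \<open>Chain rule for one-sided derivatives: since \<open>\<sigma>\<close> maps
  \<open>I\<close> onto \<open>J\<close>, the derivative of \<open>f\<close> within \<open>J\<close>
  is the one within the image of \<open>I\<close>.\<close>

lemma has_real_derivative_correspondence:
  assumes "correspondence I J \<sigma>" "s \<in> I" "(f has_real_derivative D) (at (\<sigma> s) within J)"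
  shows "((\<lambda>t. f (\<sigma> t)) has_real_derivative D * deriv_on I \<sigma> s) (at s within I)"
proof -
  have "smooth_on I \<sigma>" "\<sigma> ` I = J"
    using assms(1) by (auto simp: correspondence_def)
  then have "(\<sigma> has_real_derivative deriv_on I \<sigma> s) (at s within I)"
    using has_vector_derivative_deriv_on_funpow[of I \<sigma> s 0] assms(2)
    by (simp add: has_real_derivative_iff_has_vector_derivative)
  then show ?thesis
    using DERIV_image_chain[of f D \<sigma> s I] assms(3) \<open>\<sigma> ` I = J\<close> by (simp add: o_def)
qed

section \<open>Frenet equations and equality of adapted normals\<close>

text \<open>Differentiating \<open>x'^2 + y'^2 = 1\<close> shows that \<open>(x'', y'')\<close> is
  orthogonal to the unit vector \<open>(x', y')\<close>, hence a multiple of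
  \<open>(- y', x')\<close>; the factor is their determinant, which is the p-curvature.\<close>

lemma horizontal_Frenet:
  assumes "horizontally_regular I r" "horizontal_arc_length_param I r" "s \<in> I"
  shows "(deriv_on I ^^ 2) r s $ 1 = - p_curvature I r s * deriv_on I r s $ 2"
    and "(deriv_on I ^^ 2) r s $ 2 = p_curvature I r s * deriv_on I r s $ 1"
proof -
  define x1 y1 x2 y2 where "x1 = deriv_on I r s $ 1" and "y1 = deriv_on I r s $ 2"
    and "x2 = (deriv_on I ^^ 2) r s $ 1" and "y2 = (deriv_on I ^^ 2) r s $ 2"
  note defs = x1_def y1_def x2_def y2_def
  have unit: "x1\<^sup>2 + y1\<^sup>2 = 1"
    using assms(2,3) by (simp add: horizontal_arc_length_param_def defs)
  have I: "param_interval I"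
    using assms(1) by (simp add: horizontally_regular_def)
  note d = has_real_derivative_curve(2)[OF assms(1,3)]
  have speed: "((\<lambda>t. (deriv_on I r t $ 1)\<^sup>2 + (deriv_on I r t $ 2)\<^sup>2)
      has_real_derivative 2 * x1 * x2 + 2 * y1 * y2) (at s within I)"
    using DERIV_add[OF DERIV_power[OF d[of 1], of 2] DERIV_power[OF d[of 2], of 2]]
    by (simp add: defs mult_ac)
  have "(deriv_on I r t $ 1)\<^sup>2 + (deriv_on I r t $ 2)\<^sup>2 = 1" if "t \<in> I" for t
    using assms(2) that by (simp add: horizontal_arc_length_param_def)
  then have "2 * x1 * x2 + 2 * y1 * y2 = 0"
    by (rule param_interval_has_real_derivative_unique[OF I assms(3) _ speed DERIV_const])
  then have "x1 * x2 + y1 * y2 = 0"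
    by simp
  with unit have "x2 = - (x1 * y2 - x2 * y1) * y1" "y2 = (x1 * y2 - x2 * y1) * x1"
    by algebra+
  then show "(deriv_on I ^^ 2) r s $ 1 = - p_curvature I r s * deriv_on I r s $ 2"
    and "(deriv_on I ^^ 2) r s $ 2 = p_curvature I r s * deriv_on I r s $ 1"
    unfolding p_curvature_def defs by blast+
qed

text \<open>The third coordinate of an adapted normal is minus the planar inner product of position
  and tangent, so for equal tangents its equality is orthogonality of the displacement to the
  tangent.\<close>

lemma adapted_normal_eq_iff:
  "adapted_normal J rb u = adapted_normal I r s \<longleftrightarrow>
     deriv_on J rb u $ 1 = deriv_on I r s $ 1 \<and> deriv_on J rb u $ 2 = deriv_on I r s $ 2 \<and>
     (rb u $ 1 - r s $ 1) * deriv_on I r s $ 1 + (rb u $ 2 - r s $ 2) * deriv_on I r s $ 2 = 0"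
  by (auto simp: adapted_normal_coordinates vec_eq_iff forall_3 algebra_simps)

section \<open>From equal normals to an offset curve\<close>

lemma mate_imp_offset:
  assumes r: "horizontally_regular I r" "horizontal_arc_length_param I r"
    and rb: "horizontally_regular J rb" and \<sigma>: "correspondence I J \<sigma>"
    and normal: "\<And>s. s \<in> I \<Longrightarrow> adapted_normal J rb (\<sigma> s) = adapted_normal I r s"
  obtains a where "\<And>s. s \<in> I \<Longrightarrow> deriv_on I \<sigma> s = 1 - a * p_curvature I r s"
    and "\<And>s. s \<in> I \<Longrightarrow> rb (\<sigma> s) $ 1 = r s $ 1 - a * deriv_on I r s $ 2"
    and "\<And>s. s \<in> I \<Longrightarrow> rb (\<sigma> s) $ 2 = r s $ 2 + a * deriv_on I r s $ 1"
proof -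
  have I: "param_interval I"
    using r by (simp add: horizontally_regular_def)
  define X where "X i s = rb (\<sigma> s) $ i - r s $ i" for i s
  \<comment> \<open>The component of the displacement along \<open>(- y', x')\<close>. It is built
    from differentiable functions, so its constancy can be shown by differentiation.\<close>
  define A where "A s = X 2 s * deriv_on I r s $ 1 - X 1 s * deriv_on I r s $ 2" for s
  have mem: "\<sigma> s \<in> J" if "s \<in> I" for s
    using \<sigma> that by (auto simp: correspondence_def)
  have unit: "(deriv_on I r s $ 1)\<^sup>2 + (deriv_on I r s $ 2)\<^sup>2 = 1" if "s \<in> I" for s
    using r(2) that by (simp add: horizontal_arc_length_param_def)
  have tangent: "deriv_on J rb (\<sigma> s) $ 1 = deriv_on I r s $ 1"
      "deriv_on J rb (\<sigma> s) $ 2 = deriv_on I r s $ 2"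
    and orth: "X 1 s * deriv_on I r s $ 1 + X 2 s * deriv_on I r s $ 2 = 0" if "s \<in> I" for s
    using normal[OF that] by (simp_all add: adapted_normal_eq_iff X_def)
  \<comment> \<open>Expansion in the orthonormal frame \<open>(x', y')\<close>,
    \<open>(- y', x')\<close>; the tangential component vanishes by \<open>orth\<close>.\<close>
  have X_A: "X 1 s = - A s * deriv_on I r s $ 2" "X 2 s = A s * deriv_on I r s $ 1"
    if "s \<in> I" for s
    using unit[OF that] orth[OF that] unfolding A_def by algebra+
  have dX: "(X i has_real_derivative deriv_on I r s $ i * (deriv_on I \<sigma> s - 1)) (at s within I)"
    if "s \<in> I" "i = 1 \<or> i = 2" for s i
  proof -
    have "deriv_on J rb (\<sigma> s) $ i = deriv_on I r s $ i"
      using that tangent by auto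
    then have "((\<lambda>t. rb (\<sigma> t) $ i) has_real_derivative deriv_on I r s $ i * deriv_on I \<sigma> s)
        (at s within I)"
      using has_real_derivative_correspondence[OF \<sigma> that(1)
          has_real_derivative_curve(1)[OF rb mem[OF that(1)], of i]] by simp
    from DERIV_diff[OF this has_real_derivative_curve(1)[OF r(1) that(1)]]
    show ?thesis
      unfolding X_def[abs_def] by (simp add: algebra_simps)
  qed
  have "(A has_real_derivative 0) (at s within I)" if "s \<in> I" for s
  proof -
    define x1 y1 k m where "x1 = deriv_on I r s $ 1" and "y1 = deriv_on I r s $ 2"
      and "k = p_curvature I r s" and "m = deriv_on I \<sigma> s"
    \<comment> \<open>The product rule, left unsimplified. Read from right to left, the Frenet
      equations restore the second derivatives. The \<open>m - 1\<close> terms cancel, and what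
      remains is \<open>- k\<close> times the left-hand side of \<open>orth\<close>.\<close>
    have "(A has_real_derivative (y1 * (m - 1) * x1 + (- k * y1) * X 2 s)
        - (x1 * (m - 1) * y1 + (k * x1) * X 1 s)) (at s within I)"
      unfolding A_def[abs_def] x1_def y1_def k_def m_def
        horizontal_Frenet[OF r that, symmetric]
      by (intro DERIV_diff DERIV_mult dX that has_real_derivative_curve(2) r) auto
    moreover have "(y1 * (m - 1) * x1 + (- k * y1) * X 2 s)
        - (x1 * (m - 1) * y1 + (k * x1) * X 1 s) = 0"
      using orth[OF that, folded x1_def y1_def] by algebra
    ultimately show ?thesis
      by simp
  qed
  then obtain a where a: "\<And>s. s \<in> I \<Longrightarrow> A s = a"
    using has_field_derivative_zero_constant[of I A] I
    by (auto simp: param_interval_def is_interval_convex)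
  have "deriv_on I \<sigma> s = 1 - a * p_curvature I r s" if "s \<in> I" for s
  proof -
    define x1 y1 k m where "x1 = deriv_on I r s $ 1" and "y1 = deriv_on I r s $ 2"
      and "k = p_curvature I r s" and "m = deriv_on I \<sigma> s"
    note d = has_real_derivative_curve(2)[OF r(1) that]
    \<comment> \<open>Two derivatives of \<open>X 1\<close> are compared: the one from
      \<open>dX\<close>, and the one of \<open>- a * y'\<close>.\<close>
    have "x1 * (m - 1) = - a * (k * x1)"
      unfolding x1_def k_def m_def horizontal_Frenet[OF r that, symmetric]
      by (rule param_interval_has_real_derivative_unique[OF I that _ dX DERIV_cmult[OF d]])
        (auto simp: that X_A a)
    moreover have "y1 * (m - 1) = a * (- k * y1)"
      unfolding y1_def k_def m_def horizontal_Frenet[OF r that, symmetric]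
      by (rule param_interval_has_real_derivative_unique[OF I that _ dX DERIV_cmult[OF d]])
        (auto simp: that X_A a)
    \<comment> \<open>Either of \<open>x1\<close>, \<open>y1\<close> may vanish, so the two
      equations are weighted by \<open>x1\<close> and \<open>y1\<close> and added;
      \<open>unit\<close> then isolates \<open>m - 1\<close>.\<close>
    ultimately have "m = 1 - a * k"
      using unit[OF that, folded x1_def y1_def] by algebra
    then show ?thesis
      by (simp add: m_def k_def)
  qed
  moreover have "rb (\<sigma> s) $ 1 = r s $ 1 - a * deriv_on I r s $ 2"
    and "rb (\<sigma> s) $ 2 = r s $ 2 + a * deriv_on I r s $ 1" if "s \<in> I" for s
    using X_A[OF that] a[OF that] by (simp_all add: X_def algebra_simps)
  ultimately show ?thesis
    by (rule that)
qed

section \<open>From an offset curve to equal tangents and curvature\<close>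

text \<open>The offset equations are differentiated at \<open>s\<close>: the chain rule gives
  \<open>deriv_on I \<sigma> s\<close> times the tangent of \<open>rb\<close>, the Frenet equations
  give \<open>1 - a * p_curvature I r s\<close> times that of \<open>r\<close>. These factors are
  equal and positive, hence cancel.\<close>

lemma offset_tangent:
  assumes r: "horizontally_regular I r" "horizontal_arc_length_param I r"
    and rb: "horizontally_regular J rb" and \<sigma>: "correspondence I J \<sigma>"
    and pos: "1 - a * p_curvature I r s > 0"
    and d\<sigma>: "deriv_on I \<sigma> s = 1 - a * p_curvature I r s"
    and offset: "\<And>s. s \<in> I \<Longrightarrow> rb (\<sigma> s) $ 1 = r s $ 1 - a * deriv_on I r s $ 2"
      "\<And>s. s \<in> I \<Longrightarrow> rb (\<sigma> s) $ 2 = r s $ 2 + a * deriv_on I r s $ 1"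
    and s: "s \<in> I"
  shows "deriv_on J rb (\<sigma> s) $ 1 = deriv_on I r s $ 1"
    and "deriv_on J rb (\<sigma> s) $ 2 = deriv_on I r s $ 2"
proof -
  have I: "param_interval I"
    using r by (simp add: horizontally_regular_def)
  have "\<sigma> s \<in> J"
    using \<sigma> s by (auto simp: correspondence_def)
  note drb = has_real_derivative_correspondence[OF \<sigma> s has_real_derivative_curve(1)[OF rb this]]
  note dr = has_real_derivative_curve[OF r(1) s]
  have "deriv_on J rb (\<sigma> s) $ 1 * deriv_on I \<sigma> s
      = deriv_on I r s $ 1 - a * (p_curvature I r s * deriv_on I r s $ 1)"
    unfolding horizontal_Frenet[OF r s, symmetric]
    by (rule param_interval_has_real_derivative_unique[OF I s offset(1) drb
          DERIV_diff[OF dr(1) DERIV_cmult[OF dr(2)]]])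
  then have "deriv_on J rb (\<sigma> s) $ 1 * deriv_on I \<sigma> s = deriv_on I r s $ 1 * deriv_on I \<sigma> s"
    by (simp add: d\<sigma> algebra_simps)
  then show "deriv_on J rb (\<sigma> s) $ 1 = deriv_on I r s $ 1"
    using pos d\<sigma> by simp
  have "deriv_on J rb (\<sigma> s) $ 2 * deriv_on I \<sigma> s
      = deriv_on I r s $ 2 + a * (- p_curvature I r s * deriv_on I r s $ 2)"
    unfolding horizontal_Frenet[OF r s, symmetric]
    by (rule param_interval_has_real_derivative_unique[OF I s offset(2) drb
          DERIV_add[OF dr(1) DERIV_cmult[OF dr(2)]]])
  then have "deriv_on J rb (\<sigma> s) $ 2 * deriv_on I \<sigma> s = deriv_on I r s $ 2 * deriv_on I \<sigma> s"
    by (simp add: d\<sigma> algebra_simps)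
  then show "deriv_on J rb (\<sigma> s) $ 2 = deriv_on I r s $ 2"
    using pos d\<sigma> by simp
qed

text \<open>Differentiating the equality of tangents shows that second derivatives differ by the
  factor \<open>deriv_on I \<sigma> s\<close>, and the p-curvature is linear in the second
  derivative.\<close>

lemma p_curvature_same_tangent:
  assumes r: "horizontally_regular I r" and rb: "horizontally_regular J rb"
    and \<sigma>: "correspondence I J \<sigma>" "deriv_on I \<sigma> s \<noteq> 0"
    and tangent: "\<And>s. s \<in> I \<Longrightarrow> deriv_on J rb (\<sigma> s) $ 1 = deriv_on I r s $ 1"
      "\<And>s. s \<in> I \<Longrightarrow> deriv_on J rb (\<sigma> s) $ 2 = deriv_on I r s $ 2"
    and s: "s \<in> I"
  shows "p_curvature J rb (\<sigma> s) = p_curvature I r s / deriv_on I \<sigma> s"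
proof -
  have I: "param_interval I"
    using r by (simp add: horizontally_regular_def)
  have "\<sigma> s \<in> J"
    using \<sigma>(1) s by (auto simp: correspondence_def)
  note drb = has_real_derivative_correspondence[OF \<sigma>(1) s
      has_real_derivative_curve(2)[OF rb this]]
  note dr = has_real_derivative_curve(2)[OF r s]
  have "(deriv_on I ^^ 2) r s $ 1 = (deriv_on J ^^ 2) rb (\<sigma> s) $ 1 * deriv_on I \<sigma> s"
    by (rule sym, rule param_interval_has_real_derivative_unique[OF I s tangent(1) drb dr])
  moreover have "(deriv_on I ^^ 2) r s $ 2 = (deriv_on J ^^ 2) rb (\<sigma> s) $ 2 * deriv_on I \<sigma> s"
    by (rule sym, rule param_interval_has_real_derivative_unique[OF I s tangent(2) drb dr])
  ultimately show ?thesis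
    using \<sigma>(2) tangent[OF s] by (simp add: p_curvature_def field_simps)
qed

theorem theorem4p2:
  fixes I J :: "real set" and r rb :: "real \<Rightarrow> real^3"
  assumes "horizontally_regular I r" and "horizontal_arc_length_param I r"
    and "horizontally_regular J rb" and "horizontal_arc_length_param J rb"
    and "distinct_curves I r J rb"
  shows "(adapted_Bertrand_mate I r J rb \<longleftrightarrow>
           (\<exists>a::real. a \<noteq> 0 \<and> (\<forall>s\<in>I. 1 - a * p_curvature I r s > 0) \<and>
             (\<exists>\<sigma>. correspondence I J \<sigma> \<and>
                (\<forall>s\<in>I. deriv_on I \<sigma> s = 1 - a * p_curvature I r s) \<and>
                (\<forall>s\<in>I. rb (\<sigma> s) $ 1 = r s $ 1 - a * (deriv_on I r s $ 2) \<and>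
                       rb (\<sigma> s) $ 2 = r s $ 2 + a * (deriv_on I r s $ 1))))) \<and>
         (\<forall>(a::real) \<sigma>. a \<noteq> 0 \<longrightarrow> (\<forall>s\<in>I. 1 - a * p_curvature I r s > 0) \<longrightarrow>
             correspondence I J \<sigma> \<longrightarrow>
             (\<forall>s\<in>I. deriv_on I \<sigma> s = 1 - a * p_curvature I r s) \<longrightarrow>
             (\<forall>s\<in>I. rb (\<sigma> s) $ 1 = r s $ 1 - a * (deriv_on I r s $ 2) \<and>
                    rb (\<sigma> s) $ 2 = r s $ 2 + a * (deriv_on I r s $ 1)) \<longrightarrow>
             (\<forall>s\<in>I. p_curvature J rb (\<sigma> s) =
                p_curvature I r s / (1 - a * p_curvature I r s)))"
proof (intro conjI iffI allI impI ballI)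
  have unit: "(deriv_on I r s $ 1)\<^sup>2 + (deriv_on I r s $ 2)\<^sup>2 = 1" if "s \<in> I" for s
    using assms(2) that by (simp add: horizontal_arc_length_param_def)
  {
    assume "adapted_Bertrand_mate I r J rb"
    then obtain \<sigma> where \<sigma>: "correspondence I J \<sigma>" "orientation_preserving I \<sigma>"
      and normal: "\<And>s. s \<in> I \<Longrightarrow> adapted_normal J rb (\<sigma> s) = adapted_normal I r s"
      and ne: "\<And>s. s \<in> I \<Longrightarrow> pi_xy (rb (\<sigma> s)) \<noteq> pi_xy (r s)"
      by (auto simp: adapted_Bertrand_mate_def)
    from mate_imp_offset[OF assms(1-3) \<sigma>(1) normal] obtain a
      where a: "\<And>s. s \<in> I \<Longrightarrow> deriv_on I \<sigma> s = 1 - a * p_curvature I r s"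
        "\<And>s. s \<in> I \<Longrightarrow> rb (\<sigma> s) $ 1 = r s $ 1 - a * deriv_on I r s $ 2"
        "\<And>s. s \<in> I \<Longrightarrow> rb (\<sigma> s) $ 2 = r s $ 2 + a * deriv_on I r s $ 1"
      by blast
    obtain s0 where "s0 \<in> I"
      using assms(1) interior_subset by (fastforce simp: horizontally_regular_def param_interval_def)
    \<comment> \<open>With \<open>a = 0\<close> the projections would coincide at
      \<open>s0\<close>.\<close>
    then have "a \<noteq> 0"
      using ne[of s0] a(2,3)[of s0] by (auto simp: pi_xy_def)
    moreover have "\<forall>s\<in>I. 1 - a * p_curvature I r s > 0"
      using \<sigma>(2) a(1) by (simp add: orientation_preserving_def)
    ultimately show "\<exists>a::real. a \<noteq> 0 \<and> (\<forall>s\<in>I. 1 - a * p_curvature I r s > 0) \<and>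
        (\<exists>\<sigma>. correspondence I J \<sigma> \<and>
          (\<forall>s\<in>I. deriv_on I \<sigma> s = 1 - a * p_curvature I r s) \<and>
          (\<forall>s\<in>I. rb (\<sigma> s) $ 1 = r s $ 1 - a * (deriv_on I r s $ 2) \<and>
                 rb (\<sigma> s) $ 2 = r s $ 2 + a * (deriv_on I r s $ 1)))"
      using \<sigma>(1) a by blast
  next
    assume "\<exists>a::real. a \<noteq> 0 \<and> (\<forall>s\<in>I. 1 - a * p_curvature I r s > 0) \<and>
        (\<exists>\<sigma>. correspondence I J \<sigma> \<and>
          (\<forall>s\<in>I. deriv_on I \<sigma> s = 1 - a * p_curvature I r s) \<and>
          (\<forall>s\<in>I. rb (\<sigma> s) $ 1 = r s $ 1 - a * (deriv_on I r s $ 2) \<and>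
                 rb (\<sigma> s) $ 2 = r s $ 2 + a * (deriv_on I r s $ 1)))"
    then obtain a \<sigma> where a: "a \<noteq> 0" "\<And>s. s \<in> I \<Longrightarrow> 1 - a * p_curvature I r s > 0"
      and \<sigma>: "correspondence I J \<sigma>"
        "\<And>s. s \<in> I \<Longrightarrow> deriv_on I \<sigma> s = 1 - a * p_curvature I r s"
      and offset: "\<And>s. s \<in> I \<Longrightarrow> rb (\<sigma> s) $ 1 = r s $ 1 - a * deriv_on I r s $ 2"
        "\<And>s. s \<in> I \<Longrightarrow> rb (\<sigma> s) $ 2 = r s $ 2 + a * deriv_on I r s $ 1"
      by blast
    have "adapted_normal J rb (\<sigma> s) = adapted_normal I r s" if "s \<in> I" for s
      using offset_tangent[OF assms(1-3) \<sigma>(1) a(2) \<sigma>(2) offset] that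
      by (simp add: adapted_normal_eq_iff offset)
    \<comment> \<open>The displacement \<open>a (- y', x')\<close> has length \<open>|a|\<close>,
      since the tangent is a unit vector.\<close>
    moreover have "pi_xy (rb (\<sigma> s)) \<noteq> pi_xy (r s)" if "s \<in> I" for s
      using unit[OF that] a(1) by (auto simp: pi_xy_def offset[OF that])
    moreover have "orientation_preserving I \<sigma>"
      using a(2) \<sigma>(2) by (simp add: orientation_preserving_def)
    ultimately show "adapted_Bertrand_mate I r J rb"
      using assms \<sigma>(1) by (auto simp: adapted_Bertrand_mate_def)
  next
    fix a :: real and \<sigma> s
    assume pos: "\<forall>s\<in>I. 1 - a * p_curvature I r s > 0"
      and \<sigma>: "correspondence I J \<sigma>" "\<forall>s\<in>I. deriv_on I \<sigma> s = 1 - a * p_curvature I r s"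
      and offset: "\<forall>s\<in>I. rb (\<sigma> s) $ 1 = r s $ 1 - a * (deriv_on I r s $ 2) \<and>
                 rb (\<sigma> s) $ 2 = r s $ 2 + a * (deriv_on I r s $ 1)"
      and s: "s \<in> I"
    \<comment> \<open>Equality is needed at every \<open>t\<close>, not just at \<open>s\<close>,
      because it is differentiated next.\<close>
    have "deriv_on J rb (\<sigma> t) $ 1 = deriv_on I r t $ 1"
        "deriv_on J rb (\<sigma> t) $ 2 = deriv_on I r t $ 2" if "t \<in> I" for t
      using offset_tangent[OF assms(1-3) \<sigma>(1), of a t] pos \<sigma>(2) offset that by blast+
    then show "p_curvature J rb (\<sigma> s) = p_curvature I r s / (1 - a * p_curvature I r s)"
      using p_curvature_same_tangent[OF assms(1,3) \<sigma>(1) _ _ _ s] pos \<sigma>(2) s by force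
  }
qed

end
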